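(* Let $I$ be an inconsistency measure that satisfies Monotony, Independent Decomposability and MinInc. Then $I(K)\ge\mu_{\mathcal D}(K)$ for every knowledge base $K$.
   Context: Formulae are those of classical propositional logic over a finite set $\mathcal P$ of propositional symbols; $\vdash$ is classical deduction. A knowledge base (KB) is a finite set of formulae; a set of formulae $X$ is inconsistent iff $X\vdash\bot$. An inconsistency measure is a function $I$ assigning a real number to every KB. A MUS of a KB $K$ is a set $M\subseteq K$ with $M\vdash\bot$ such that no proper subset of $M$ is inconsistent; $\mathrm{MUSes}(K)$ is the set of all MUSes of $K$. $\mathrm{unfree}(K)$ is the set of formulae of $K$ belonging to at least one MUS of $K$. $C=A_1\oplus\cdots\oplus A_n$ means that $C=A_1\cup\cdots\cup A_n$ and the $A_i$ are pairwise disjoint (possibly empty). Monotony: $I(K)\le I(K\cup K')$ for all KBs $K,K'$. MinInc: for every KB $K$ and $M\in\mathrm{MUSes}(K)$, $I(M)=1$. Independent Decomposability: for all KBs $K_1,\ldots,K_n$, if $\mathrm{MUSes}(K_1\cup\cdots\cup K_n)=\mathrm{MUSes}(K_1)\oplus\cdots\oplus\mathrm{MUSes}(K_n)$ and $\mathrm{unfree}(K_i)\cap\mathrm{unfree}(K_j)=\emptyset$ for all $i\neq j$, then $I(K_1\cup\cdots\cup K_n)=I(K_1)+\cdots+I(K_n)$. A partial MUS-decomposition of $K$ is a set $\{K_1,\ldots,K_n\}$ of subsets of $K$ ($n\ge1$) such that (1) $K_i\vdash\bot$ for all $i$; (2) $\mathrm{MUSes}(K_1\cup\cdots\cup K_n)=\mathrm{MUSes}(K_1)\oplus\cdots\oplus\mathrm{MUSes}(K_n)$;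 (3) $K_i\cap K_j=\emptyset$ for all $i\ne j$. The distribution index $\mu_{\mathcal D}(K)$ is the maximal cardinality of a partial MUS-decomposition of $K$, with $\mu_{\mathcal D}(K)=0$ if $K$ is consistent (i.e. has no partial MUS-decomposition). *)

theory Defs
  imports Complex_Main "HOL-Library.Disjoint_Sets"
begin

datatype (atoms: 'p) form =
    Atom 'p
  | Bot
  | Neg "'p form"
  | And "'p form" "'p form"
  | Or "'p form" "'p form"
  | Imp "'p form" "'p form"

(* Classical natural deduction. Derivations are closed under substitution, so intermediate
   formulae with atoms outside a signature P can be eliminated by replacing these atoms by Bot:
   nothing more is derivable about formulae over P than by derivations over P alone. *)
inductive deduces :: "'p form set \<Rightarrow> 'p form \<Rightarrow> bool" (infix "\<turnstile>" 50) where
  Assm: "\<phi> \<in> \<Gamma> \<Longrightarrow> \<Gamma> \<turnstile> \<phi>"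
| RAA: "insert (Neg \<phi>) \<Gamma> \<turnstile> Bot \<Longrightarrow> \<Gamma> \<turnstile> \<phi>"
| NegI: "insert \<phi> \<Gamma> \<turnstile> Bot \<Longrightarrow> \<Gamma> \<turnstile> Neg \<phi>"
| NegE: "\<Gamma> \<turnstile> Neg \<phi> \<Longrightarrow> \<Gamma> \<turnstile> \<phi> \<Longrightarrow> \<Gamma> \<turnstile> Bot"
| AndI: "\<Gamma> \<turnstile> \<phi> \<Longrightarrow> \<Gamma> \<turnstile> \<psi> \<Longrightarrow> \<Gamma> \<turnstile> And \<phi> \<psi>"
| AndE1: "\<Gamma> \<turnstile> And \<phi> \<psi> \<Longrightarrow> \<Gamma> \<turnstile> \<phi>"
| AndE2: "\<Gamma> \<turnstile> And \<phi> \<psi> \<Longrightarrow> \<Gamma> \<turnstile> \<psi>"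
| OrI1: "\<Gamma> \<turnstile> \<phi> \<Longrightarrow> \<Gamma> \<turnstile> Or \<phi> \<psi>"
| OrI2: "\<Gamma> \<turnstile> \<psi> \<Longrightarrow> \<Gamma> \<turnstile> Or \<phi> \<psi>"
| OrE: "\<Gamma> \<turnstile> Or \<phi> \<psi> \<Longrightarrow> insert \<phi> \<Gamma> \<turnstile> \<chi> \<Longrightarrow> insert \<psi> \<Gamma> \<turnstile> \<chi> \<Longrightarrow> \<Gamma> \<turnstile> \<chi>"
| ImpI: "insert \<phi> \<Gamma> \<turnstile> \<psi> \<Longrightarrow> \<Gamma> \<turnstile> Imp \<phi> \<psi>"
| ImpE: "\<Gamma> \<turnstile> Imp \<phi> \<psi> \<Longrightarrow> \<Gamma> \<turnstile> \<phi> \<Longrightarrow> \<Gamma> \<turnstile> \<psi>"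

definition inconsistent :: "'p form set \<Rightarrow> bool" where
  "inconsistent X \<longleftrightarrow> X \<turnstile> Bot"

definition KBs :: "'p set \<Rightarrow> 'p form set set" where
  "KBs P = {K. finite K \<and> (\<forall>\<phi>\<in>K. atoms \<phi> \<subseteq> P)}"

definition MUSes :: "'p form set \<Rightarrow> 'p form set set" where
  "MUSes K = {M. M \<subseteq> K \<and> inconsistent M \<and> (\<forall>M'. M' \<subset> M \<longrightarrow> \<not> inconsistent M')}"

definition unfree :: "'p form set \<Rightarrow> 'p form set" where
  "unfree K = {\<phi> \<in> K. \<exists>M\<in>MUSes K. \<phi> \<in> M}"

definition is_disjoint_union :: "'a set \<Rightarrow> ('i \<Rightarrow> 'a set) \<Rightarrow> 'i set \<Rightarrow> bool" where
  "is_disjoint_union C A S \<longleftrightarrow> C = (\<Union>i\<in>S. A i) \<and> disjoint_family_on A S"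

(* An inconsistency measure over the signature P is a function on KBs P; it is represented by a
   total function whose values outside KBs P are never referred to. *)

definition monotony :: "'p set \<Rightarrow> ('p form set \<Rightarrow> real) \<Rightarrow> bool" where
  "monotony P I \<longleftrightarrow> (\<forall>K\<in>KBs P. \<forall>K'\<in>KBs P. I K \<le> I (K \<union> K'))"

definition min_inc :: "'p set \<Rightarrow> ('p form set \<Rightarrow> real) \<Rightarrow> bool" where
  "min_inc P I \<longleftrightarrow> (\<forall>K\<in>KBs P. \<forall>M\<in>MUSes K. I M = 1)"

definition independent_decomposability :: "'p set \<Rightarrow> ('p form set \<Rightarrow> real) \<Rightarrow> bool" where
  "independent_decomposability P I \<longleftrightarrow>
    (\<forall>(n::nat) K. n \<ge> 1 \<longrightarrow> (\<forall>i\<in>{1..n}. K i \<in> KBs P) \<longrightarrow>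
      is_disjoint_union (MUSes (\<Union>i\<in>{1..n}. K i)) (\<lambda>i. MUSes (K i)) {1..n} \<longrightarrow>
      (\<forall>i\<in>{1..n}. \<forall>j\<in>{1..n}. i \<noteq> j \<longrightarrow> unfree (K i) \<inter> unfree (K j) = {}) \<longrightarrow>
      I (\<Union>i\<in>{1..n}. K i) = (\<Sum>i=1..n. I (K i)))"

definition partial_MUS_decomposition :: "'p form set \<Rightarrow> 'p form set set \<Rightarrow> bool" where
  "partial_MUS_decomposition K D \<longleftrightarrow>
    finite D \<and> D \<noteq> {} \<and> (\<forall>A\<in>D. A \<subseteq> K) \<and>
    (\<forall>A\<in>D. inconsistent A) \<and>
    is_disjoint_union (MUSes (\<Union>D)) MUSes D \<and>
    (\<forall>A\<in>D. \<forall>B\<in>D. A \<noteq> B \<longrightarrow> A \<inter> B = {})"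

(* For finite inconsistent K the maximum is over a finite set, which is nonempty because {K}
   is a partial MUS-decomposition of K. *)
definition distribution_index :: "'p form set \<Rightarrow> nat" where
  "distribution_index K =
    (if inconsistent K then Max {card D |D. partial_MUS_decomposition K D} else 0)"

end

theory Submission
  imports Defs
begin

text \<open>Each member of a partial MUS-decomposition contains a MUS, so by Monotony and MinInc its
  measure is at least 1; Independent Decomposability adds these values up on the union, and Monotony
  passes from the union to \<open>K\<close>. For consistent \<open>K\<close>, decomposing \<open>K = K \<union> K\<close> gives
  \<open>I K = I K + I K\<close>, hence \<open>I K = 0\<close>.\<close>

text \<open>Induction on the derivation. The context \<open>\<Delta>\<close> must be arbitrary,
  since rules that discharge an assumption use the induction hypothesis for an enlarged
  context.\<close>

lemma deduces_mono: "\<Gamma> \<turnstile> \<phi> \<Longrightarrow> \<Gamma> \<subseteq> \<Delta> \<Longrightarrow> \<Delta> \<turnstile> \<phi>"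
proof (induction arbitrary: \<Delta> rule: deduces.induct)
  case Assm
  then show ?case by (blast intro: deduces.Assm)
next
  case RAA
  then show ?case by (metis deduces.RAA insert_mono)
next
  case NegI
  then show ?case by (metis deduces.NegI insert_mono)
next
  case NegE
  then show ?case by (metis deduces.NegE)
next
  case AndI
  then show ?case by (metis deduces.AndI)
next
  case AndE1
  then show ?case by (metis deduces.AndE1)
next
  case AndE2
  then show ?case by (metis deduces.AndE2)
next
  case OrI1
  then show ?case by (metis deduces.OrI1)
next
  case OrI2
  then show ?case by (metis deduces.OrI2)
next
  case OrE
  then show ?case by (metis deduces.OrE insert_mono)
next
  case ImpI
  then show ?case by (metis deduces.ImpI insert_mono)
next
  case ImpE
  then show ?case by (metis deduces.ImpE)
qed

lemma inconsistent_mono: "inconsistent X \<Longrightarrow> X \<subseteq> Y \<Longrightarrow> inconsistent Y"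
  unfolding inconsistent_def by (rule deduces_mono)

lemma MUSes_eq_empty: "\<not> inconsistent K \<Longrightarrow> MUSes K = {}"
  unfolding MUSes_def using inconsistent_mono by blast

text \<open>Descent along proper subsets: as long as a smaller inconsistent set exists, pass to it.
  Finiteness makes the descent stop.\<close>

lemma MUS_exists:
  assumes "finite K" and "inconsistent K"
  shows "\<exists>M. M \<in> MUSes K"
  using assms
proof (induction K rule: finite_psubset_induct)
  case (psubset K)
  show ?case
  proof (cases "\<exists>K'. K' \<subset> K \<and> inconsistent K'")
    case True
    then obtain K' M where "K' \<subset> K" "M \<in> MUSes K'"
      using psubset.IH by blast
    \<comment> \<open>Minimality of \<open>M\<close> refers only to subsets of \<open>M\<close>, so
      it does not depend on the surrounding set.\<close>
    then have "M \<in> MUSes K" unfolding MUSes_def by blast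
    then show ?thesis ..
  next
    case False
    with psubset.prems have "K \<in> MUSes K" unfolding MUSes_def by blast
    then show ?thesis ..
  qed
qed

text \<open>The postulates constrain \<open>I\<close> only on \<open>KBs P\<close>, so MUSes and
  members of decompositions must be known to lie there.\<close>

lemma KBs_subset: "K \<in> KBs P \<Longrightarrow> A \<subseteq> K \<Longrightarrow> A \<in> KBs P"
  unfolding KBs_def by (auto intro: finite_subset)

lemma monotony_subset:
  assumes "monotony P I" and "K \<in> KBs P" and "A \<subseteq> K"
  shows "I A \<le> I K"
proof -
  have "I A \<le> I (A \<union> K)"
    using assms KBs_subset unfolding monotony_def by blast
  with assms(3) show ?thesis by (simp add: Un_absorb1)
qed

lemma inconsistent_measure_ge_1:
  assumes "monotony P I" and "min_inc P I" and "K \<in> KBs P" and "inconsistent K"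
  shows "I K \<ge> 1"
proof -
  obtain M where M: "M \<in> MUSes K"
    using MUS_exists assms(3,4) unfolding KBs_def by blast
  then have "I M = 1" using assms(2,3) unfolding min_inc_def by blast
  moreover have "M \<subseteq> K" using M unfolding MUSes_def by blast
  ultimately show ?thesis using monotony_subset[OF assms(1,3), of M] by simp
qed

lemma consistent_measure_eq_0:
  assumes "independent_decomposability P I" and "K \<in> KBs P" and "\<not> inconsistent K"
  shows "I K = 0"
proof -
  \<comment> \<open>The postulate speaks of indexed families, so \<open>K\<close> may occur twice.
    The two copies count as disjoint because each has no MUSes.\<close>
  have "is_disjoint_union (MUSes (\<Union>i\<in>{1..2::nat}. K)) (\<lambda>i. MUSes K) {1..2::nat}"
    using MUSes_eq_empty[OF assms(3)]
    by (simp add: is_disjoint_union_def disjoint_family_on_def)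
  moreover have "unfree K = {}"
    using MUSes_eq_empty[OF assms(3)] by (simp add: unfree_def)
  ultimately have "I (\<Union>i\<in>{1..2::nat}. K) = (\<Sum>i=1..2::nat. I K)"
    using assms(1)[unfolded independent_decomposability_def, rule_format,
        of "2::nat" "\<lambda>_. K"] assms(2) by simp
  then show ?thesis by simp
qed

text \<open>Bridges two encodings: the postulate is about families indexed by \<open>{1..n}\<close>,
  whereas a decomposition is a set of KBs. An enumeration of \<open>D\<close> without repetitions
  translates one into the other.\<close>

lemma independent_decomposability_set:
  assumes ID: "independent_decomposability P I"
    and D: "finite D" "D \<noteq> {}" "D \<subseteq> KBs P"
    and MUS: "is_disjoint_union (MUSes (\<Union>D)) MUSes D"
    and unfree: "\<And>A B. A \<in> D \<Longrightarrow> B \<in> D \<Longrightarrow> A \<noteq> B \<Longrightarrow> unfree A \<inter> unfree B = {}"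
  shows "I (\<Union>D) = (\<Sum>A\<in>D. I A)"
proof -
  obtain h where h: "bij_betw h {1..card D} D"
    using ex_bij_betw_nat_finite_1[OF D(1)] by blast
  have img: "h ` {1..card D} = D" and inj: "inj_on h {1..card D}"
    using h by (auto simp: bij_betw_def)
  have "card D \<ge> 1" using D(1,2) by (simp add: Suc_le_eq card_gt_0_iff)
  moreover have "\<forall>i\<in>{1..card D}. h i \<in> KBs P" using img D(3) by blast
  moreover have "MUSes (\<Union>i\<in>{1..card D}. h i) = (\<Union>i\<in>{1..card D}. MUSes (h i))"
  proof -
    have "(\<Union>i\<in>{1..card D}. MUSes (h i)) = \<Union>(MUSes ` D)"
      by (metis img image_image)
    then show ?thesis using MUS img by (simp add: is_disjoint_union_def)
  qed
  moreover have "disjoint_family_on (\<lambda>i. MUSes (h i)) {1..card D}"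
    unfolding disjoint_family_on_def
  proof (intro ballI impI)
    fix i j assume ij: "i \<in> {1..card D}" "j \<in> {1..card D}" "i \<noteq> j"
    \<comment> \<open>Injectivity of \<open>h\<close> turns distinct indices into distinct members
      of \<open>D\<close>, to which the disjointness of MUSes applies.\<close>
    then have "h i \<in> D" "h j \<in> D" "h i \<noteq> h j"
      using img inj_onD[OF inj] by blast+
    with MUS show "MUSes (h i) \<inter> MUSes (h j) = {}"
      by (simp add: is_disjoint_union_def disjoint_family_on_def)
  qed
  moreover have "\<forall>i\<in>{1..card D}. \<forall>j\<in>{1..card D}. i \<noteq> j \<longrightarrow> unfree (h i) \<inter> unfree (h j) = {}"
  proof (intro ballI impI)
    fix i j assume ij: "i \<in> {1..card D}" "j \<in> {1..card D}" "i \<noteq> j"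
    then have "h i \<in> D" "h j \<in> D" "h i \<noteq> h j"
      using img inj_onD[OF inj] by blast+
    then show "unfree (h i) \<inter> unfree (h j) = {}" by (rule unfree)
  qed
  ultimately have "I (\<Union>i\<in>{1..card D}. h i) = (\<Sum>i=1..card D. I (h i))"
    using ID unfolding independent_decomposability_def is_disjoint_union_def by blast
  also have "\<dots> = (\<Sum>A\<in>D. I A)" using h by (rule sum.reindex_bij_betw)
  finally show ?thesis by (simp only: img)
qed

lemma partial_MUS_decomposition_card_le:
  assumes "monotony P I" and "independent_decomposability P I" and "min_inc P I"
    and K: "K \<in> KBs P" and D: "partial_MUS_decomposition K D"
  shows "real (card D) \<le> I K"
proof -
  have KB: "D \<subseteq> KBs P"
    using D by (auto simp: partial_MUS_decomposition_def intro: KBs_subset[OF K])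
  have "real (card D) = (\<Sum>A\<in>D. 1)" by simp
  also have "\<dots> \<le> (\<Sum>A\<in>D. I A)"
  proof (rule sum_mono)
    fix A assume "A \<in> D"
    then have "A \<in> KBs P" "inconsistent A"
      using KB D unfolding partial_MUS_decomposition_def by auto
    then show "1 \<le> I A" by (rule inconsistent_measure_ge_1[OF assms(1,3)])
  qed
  also have "\<dots> = I (\<Union>D)"
  proof (rule independent_decomposability_set[OF assms(2) _ _ KB, symmetric])
    fix A B assume "A \<in> D" "B \<in> D" "A \<noteq> B"
    then have "A \<inter> B = {}" using D unfolding partial_MUS_decomposition_def by blast
    \<comment> \<open>Disjointness of the members is inherited by their unfree parts, as
      \<open>unfree A\<close> is contained in \<open>A\<close>.\<close>
    then show "unfree A \<inter> unfree B = {}" unfolding unfree_def by blast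
  qed (use D in \<open>auto simp: partial_MUS_decomposition_def\<close>)
  also have "\<dots> \<le> I K"
    using D by (intro monotony_subset[OF assms(1) K]) (auto simp: partial_MUS_decomposition_def)
  finally show ?thesis .
qed

text \<open>\<open>Max\<close> is only meaningful on a finite nonempty set. Decompositions are sets
  of subsets of \<open>K\<close>, hence finitely many, and \<open>{K}\<close> is one of them. A
  bound for every decomposition thus becomes a bound for the index.\<close>

lemma distribution_index_attained:
  assumes "finite K" and "inconsistent K"
  shows "\<exists>D. partial_MUS_decomposition K D \<and> card D = distribution_index K"
proof -
  let ?S = "{card D |D. partial_MUS_decomposition K D}"
  have "{D. partial_MUS_decomposition K D} \<subseteq> Pow (Pow K)"
    by (auto simp: partial_MUS_decomposition_def)
  then have "finite {D. partial_MUS_decomposition K D}"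
    by (rule finite_subset) (simp add: assms(1))
  then have "finite ?S" by simp
  moreover have "partial_MUS_decomposition K {K}"
    using assms(2)
    by (simp add: partial_MUS_decomposition_def is_disjoint_union_def disjoint_family_on_def)
  then have "?S \<noteq> {}" by blast
  ultimately have "Max ?S \<in> ?S" by (rule Max_in)
  with assms(2) show ?thesis by (auto simp: distribution_index_def)
qed

theorem proposition12:
  fixes P :: "'p set" and I :: "'p form set \<Rightarrow> real"
  assumes "finite P"
    and "monotony P I"
    and "independent_decomposability P I"
    and "min_inc P I"
  shows "\<forall>K\<in>KBs P. I K \<ge> real (distribution_index K)"
proof
  fix K assume K: "K \<in> KBs P"
  show "I K \<ge> real (distribution_index K)"
  proof (cases "inconsistent K")
    case True
    then obtain D where "partial_MUS_decomposition K D" "card D = distribution_index K"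
      using distribution_index_attained K unfolding KBs_def by blast
    then show ?thesis
      using partial_MUS_decomposition_card_le[OF assms(2-4) K] by metis
  next
    \<comment> \<open>Here the index is 0 by definition, so \<open>I K = 0\<close> suffices.\<close>
    case False
    then show ?thesis
      using consistent_measure_eq_0[OF assms(3) K] by (simp add: distribution_index_def)
  qed
qed

end
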